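(* For every $\varepsilon>0$ and every integer $g\ge 1$ there is a $B_3[g]$ sequence $A$ such that $A(x)\gg x^{\frac{g}{3g+2}-\varepsilon}$.
   Context: Sequences of integers are identified with sets of integers. For a set $A$ of integers and an integer $n$, let $r_{3,A}(n)=|\{(a_1,a_2,a_3) : n=a_1+a_2+a_3,\ a_1\le a_2\le a_3,\ a_i\in A\}|$. The set $A$ is called a $B_3[g]$ sequence if $r_{3,A}(n)\le g$ for every integer $n$. The counting function is $A(x)=|A\cap[1,x]|$. The notation $A(x)\gg f(x)$ means that there are a constant $c>0$ (which may depend on $A$, $g$, $\varepsilon$) and $x_0$ such that $A(x)\ge c f(x)$ for all $x\ge x_0$. *)

theory Defs
  imports Complex_Main
begin

definition reps3 :: "int set \<Rightarrow> int \<Rightarrow> (int \<times> int \<times> int) set" where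
  "reps3 A n = {(a1, a2, a3). a1 \<in> A \<and> a2 \<in> A \<and> a3 \<in> A \<and>
      a1 \<le> a2 \<and> a2 \<le> a3 \<and> n = a1 + a2 + a3}"

definition r3 :: "int set \<Rightarrow> int \<Rightarrow> nat" where
  "r3 A n = card (reps3 A n)"

(* A may contain infinitely many negative integers, so an integer can have infinitely many
   representations. As card is 0 on infinite sets, finiteness has to be required separately. *)
definition B3_seq :: "nat \<Rightarrow> int set \<Rightarrow> bool" where
  "B3_seq g A \<longleftrightarrow> (\<forall>n. finite (reps3 A n) \<and> r3 A n \<le> g)"

definition counting :: "int set \<Rightarrow> real \<Rightarrow> nat" where
  "counting A x = card {a \<in> A. 1 \<le> a \<and> real_of_int a \<le> x}"

definition dominates :: "(real \<Rightarrow> real) \<Rightarrow> (real \<Rightarrow> real) \<Rightarrow> bool" (infix "\<ggreater>" 50) where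
  "F \<ggreater> f \<longleftrightarrow> (\<exists>c>0. \<exists>x0. \<forall>x\<ge>x0. F x \<ge> c * f x)"

end

theory Submission
  imports Defs
begin

text \<open>
  The set is built one element at a time, by a greedy choice that keeps a list of counts small. It
  yields the exponent \<open>g / (3 * g + 2)\<close> itself (\<open>exists_dense_B3_seq\<close>), and
  \<open>x powr (g / (3 * g + 2) - \<epsilon>)\<close> is a smaller function for \<open>x \<ge> 1\<close>.

  Throughout, the finite set \<open>A\<close> of \<open>m\<close> elements chosen so far is a Sidon set. Then two
  representations \<open>n = x + b + c\<close> with the same \<open>x\<close> coincide, so a new element \<open>x\<close> raises
  the number of representations of each integer by at most one, and raises it only on the sums
  \<open>x + b + c\<close> (\<open>r3_insert_le\<close>). Let \<open>R j\<close> be the number of integers with at least \<open>j\<close>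
  representations. The increase of \<open>R (j + 1)\<close> is at most the number of sums \<open>x + b + c\<close> among
  the integers counted by \<open>R j\<close>. Each of these integers is such a sum for at most
  \<open>3 * m\<^sup>2\<close> values of \<open>x\<close>, so if \<open>x\<close> ranges over \<open>N\<close> candidates, the average increase
  of \<open>R (j + 1)\<close> is at most \<open>3 * m\<^sup>2 * R j / N\<close>.

  Start from \<open>R 1 \<le> m ^ 3\<close> and let \<open>N\<close> be a large multiple of \<open>m powr (3 + 2 / g)\<close>. Each
  further level then loses a factor \<open>m powr (2 / g)\<close>: the bound
  \<open>R (j + 1) \<le> m powr (3 - 2 * j / g)\<close> persists, and for \<open>j = g\<close> the average increase is
  below 1. One choice of \<open>x\<close> serves all levels at once and avoids the at most \<open>2 * m ^ 3\<close>
  values that would destroy the Sidon property (\<open>balanced_extend\<close>); it does not increase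
  \<open>R (g + 1)\<close>, which stays zero. So the element number \<open>m\<close> is of size
  \<open>O(m powr (3 + 2 / g))\<close>, and \<open>3 + 2 / g\<close> is the reciprocal of \<open>g / (3 * g + 2)\<close>.
\<close>

section \<open>Sidon sets and representations by three summands\<close>

definition sidon :: "int set \<Rightarrow> bool" where
  "sidon A \<longleftrightarrow> (\<forall>a\<in>A. \<forall>b\<in>A. \<forall>c\<in>A. \<forall>d\<in>A. a + b = c + d \<longrightarrow> a = c \<or> a = d)"

definition rich :: "nat \<Rightarrow> int set \<Rightarrow> int set" where
  "rich j A = {n. j \<le> r3 A n}"

text \<open>The integers that can gain a representation when \<open>x\<close> joins \<open>A\<close>; the other two summands may
  be equal to \<open>x\<close> as well.\<close>

definition new_sums :: "int \<Rightarrow> int set \<Rightarrow> int set" where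
  "new_sums x A = {n. \<exists>b\<in>insert x A. \<exists>c\<in>insert x A. n = x + b + c}"

lemma sidonD:
  assumes "sidon A" "a \<in> A" "b \<in> A" "c \<in> A" "d \<in> A" "a + b = c + d"
  shows "a = c \<and> b = d \<or> a = d \<and> b = c"
proof -
  have "a = c \<or> a = d" using assms unfolding sidon_def by blast
  thus ?thesis using assms(6) by auto
qed

lemma reps3_subset: "reps3 A n \<subseteq> A \<times> A \<times> A"
  by (auto simp: reps3_def)

lemma finite_reps3: "finite A \<Longrightarrow> finite (reps3 A n)"
  by (rule finite_subset[OF reps3_subset]) auto

lemma reps3_mono: "A \<subseteq> B \<Longrightarrow> reps3 A n \<subseteq> reps3 B n"
  by (auto simp: reps3_def)

lemma finite_reps3_positive:
  assumes "A \<subseteq> {1..}"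
  shows "finite (reps3 A n)"
proof (rule finite_subset)
  show "reps3 A n \<subseteq> {1..n} \<times> {1..n} \<times> {1..n}"
  proof
    fix t assume t: "t \<in> reps3 A n"
    obtain a b c where abc: "t = (a, b, c)" by (metis surj_pair)
    have "a \<in> A" "b \<in> A" "c \<in> A" "n = a + b + c"
      using t by (simp_all add: reps3_def abc)
    moreover from this have "1 \<le> a" "1 \<le> b" "1 \<le> c"
      using assms by (blast dest: atLeast_iff[THEN iffD1])+
    ultimately show "t \<in> {1..n} \<times> {1..n} \<times> {1..n}" by (simp add: abc)
  qed
  show "finite ({1..n} \<times> {1..n} \<times> {1..n})" by simp
qed

lemma rich_1_subset: "rich 1 A \<subseteq> (\<lambda>(a, b, c). a + b + c) ` (A \<times> A \<times> A)"
proof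
  fix n assume "n \<in> rich 1 A"
  hence "reps3 A n \<noteq> {}" by (auto simp: rich_def r3_def)
  then obtain a b c where "(a, b, c) \<in> reps3 A n" by auto
  hence "(a, b, c) \<in> A \<times> A \<times> A" "n = a + b + c" by (auto simp: reps3_def)
  thus "n \<in> (\<lambda>(a, b, c). a + b + c) ` (A \<times> A \<times> A)" by (intro image_eqI[of _ _ "(a, b, c)"]) simp_all
qed

lemma finite_rich:
  assumes "finite A" "1 \<le> j"
  shows "finite (rich j A)"
proof (rule finite_subset)
  show "rich j A \<subseteq> rich 1 A" using assms by (auto simp: rich_def)
  show "finite (rich 1 A)" by (rule finite_subset[OF rich_1_subset]) (use assms in auto)
qed

lemma card_rich_1_le:
  assumes "finite A"
  shows "card (rich 1 A) \<le> card A ^ 3"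
proof -
  have "card (rich 1 A) \<le> card (A \<times> A \<times> A)"
    using assms by (intro surj_card_le[OF _ rich_1_subset]) auto
  thus ?thesis by (simp add: card_cartesian_product power3_eq_cube)
qed

text \<open>Two new representations of \<open>n\<close> both contain \<open>x\<close>. Their remaining pairs have the same sum
  \<open>n - x\<close>, hence coincide in a Sidon set, and a sorted triple is determined by its entries.\<close>

lemma card_new_reps3_le_1:
  assumes S: "sidon (insert x A)"
  shows "card (reps3 (insert x A) n - reps3 A n) \<le> 1"
proof -
  have "s = t" if s: "s \<in> reps3 (insert x A) n - reps3 A n"
    and t: "t \<in> reps3 (insert x A) n - reps3 A n" for s t
  proof -
    let ?B = "insert x A"
    obtain a1 a2 a3 where a: "s = (a1, a2, a3)" by (metis surj_pair)
    obtain b1 b2 b3 where b: "t = (b1, b2, b3)" by (metis surj_pair)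
    have A: "a1 \<in> ?B" "a2 \<in> ?B" "a3 \<in> ?B" "a1 \<le> a2" "a2 \<le> a3" "n = a1 + a2 + a3"
      "x = a1 \<or> x = a2 \<or> x = a3"
      using s unfolding a reps3_def by auto
    have B: "b1 \<in> ?B" "b2 \<in> ?B" "b3 \<in> ?B" "b1 \<le> b2" "b2 \<le> b3" "n = b1 + b2 + b3"
      "x = b1 \<or> x = b2 \<or> x = b3"
      using t unfolding b reps3_def by auto
    obtain p q where p: "p \<in> ?B" "q \<in> ?B" "p \<le> q" "n = x + p + q"
      "x = a1 \<and> p = a2 \<and> q = a3 \<or> x = a2 \<and> p = a1 \<and> q = a3 \<or> x = a3 \<and> p = a1 \<and> q = a2"
      using A(7)
    proof (elim disjE)
      assume "x = a1" thus ?thesis using A by (intro that[of a2 a3]) auto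
    next
      assume "x = a2" thus ?thesis using A by (intro that[of a1 a3]) auto
    next
      assume "x = a3" thus ?thesis using A by (intro that[of a1 a2]) auto
    qed
    obtain p' q' where p': "p' \<in> ?B" "q' \<in> ?B" "p' \<le> q'" "n = x + p' + q'"
      "x = b1 \<and> p' = b2 \<and> q' = b3 \<or> x = b2 \<and> p' = b1 \<and> q' = b3 \<or> x = b3 \<and> p' = b1 \<and> q' = b2"
      using B(7)
    proof (elim disjE)
      assume "x = b1" thus ?thesis using B by (intro that[of b2 b3]) auto
    next
      assume "x = b2" thus ?thesis using B by (intro that[of b1 b3]) auto
    next
      assume "x = b3" thus ?thesis using B by (intro that[of b1 b2]) auto
    qed
    have "p = p' \<and> q = q'"
      using sidonD[OF S p(1,2) p'(1,2)] p(3,4) p'(3,4) by auto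
    thus "s = t" unfolding a b using p(5) p'(5) A(4,5) B(4,5) by auto
  qed
  thus ?thesis
    by (cases "finite (reps3 (insert x A) n - reps3 A n)") (simp_all add: card_le_Suc0_iff_eq)
qed

lemma r3_insert_le:
  assumes "finite A" "sidon (insert x A)"
  shows "r3 (insert x A) n \<le> r3 A n + (if n \<in> new_sums x A then 1 else 0)"
proof -
  let ?N = "reps3 (insert x A) n - reps3 A n"
  have sub: "reps3 A n \<subseteq> reps3 (insert x A) n" by (rule reps3_mono) blast
  have fin: "finite (reps3 (insert x A) n)" using assms(1) by (intro finite_reps3) auto
  have "r3 (insert x A) n = r3 A n + card ?N"
    using card_Diff_subset[OF finite_reps3[OF assms(1)] sub] card_mono[OF fin sub]
    by (simp add: r3_def)
  moreover have "card ?N = 0" if "n \<notin> new_sums x A"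
  proof -
    have "a \<in> A \<and> b \<in> A \<and> c \<in> A" if "(a, b, c) \<in> reps3 (insert x A) n" for a b c
    proof -
      have "a \<in> insert x A" "b \<in> insert x A" "c \<in> insert x A"
        and "n = a + b + c" "n = b + a + c" "n = c + a + b"
        using that by (auto simp: reps3_def)
      thus ?thesis using \<open>n \<notin> new_sums x A\<close> unfolding new_sums_def by blast
    qed
    hence "?N = {}" by (auto simp: reps3_def)
    thus ?thesis by (simp only: card.empty)
  qed
  ultimately show ?thesis using card_new_reps3_le_1[OF assms(2), of n] by auto
qed

text \<open>An integer rises by at most one level, so it can newly reach the level \<open>j + 1\<close> only from the
  level \<open>j\<close>.\<close>

lemma rich_insert_subset:
  assumes "finite A" "sidon (insert x A)"
  shows "rich (Suc j) (insert x A) \<subseteq> rich (Suc j) A \<union> (rich j A \<inter> new_sums x A)"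
proof
  fix n assume "n \<in> rich (Suc j) (insert x A)"
  thus "n \<in> rich (Suc j) A \<union> (rich j A \<inter> new_sums x A)"
    using r3_insert_le[OF assms, of n] by (auto simp: rich_def split: if_splits)
qed

section \<open>Counting the harmful candidates\<close>

lemma card_times_le_square:
  assumes "finite A"
  shows "card ((\<lambda>(b, c). f b c) ` (A \<times> A)) \<le> (card A)\<^sup>2"
  using card_image_le[of "A \<times> A" "\<lambda>(b, c). f b c"] assms
  by (simp add: card_cartesian_product power2_eq_square)

text \<open>In \<open>n = x + b + c\<close> the candidate \<open>x\<close> occurs once, twice or three times; it is then
  determined by two, one or no elements of \<open>A\<close>, which gives \<open>m\<^sup>2 + m + 1\<close> values for
  \<open>m = card A\<close>.\<close>

lemma card_completing_le:
  assumes "finite A" "A \<noteq> {}"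
  shows "finite {x. n \<in> new_sums x A}" "card {x. n \<in> new_sums x A} \<le> 3 * (card A)\<^sup>2"
proof -
  let ?P = "(\<lambda>(b, c). n - b - c) ` (A \<times> A)" and ?Q = "(\<lambda>b. (n - b) div 2) ` A"
  have sub: "{x. n \<in> new_sums x A} \<subseteq> ?P \<union> ?Q \<union> {n div 3}"
  proof
    fix x assume "x \<in> {x. n \<in> new_sums x A}"
    then obtain b c where "b \<in> insert x A" "c \<in> insert x A" "n = x + b + c"
      unfolding new_sums_def by blast
    then consider "b \<in> A" "c \<in> A" "x = n - b - c" | "b \<in> A" "x = (n - b) div 2"
      | "c \<in> A" "x = (n - c) div 2" | "x = n div 3"
      by force
    thus "x \<in> ?P \<union> ?Q \<union> {n div 3}" by cases auto
  qed
  have fin: "finite (?P \<union> ?Q \<union> {n div 3})" using assms by auto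
  show "finite {x. n \<in> new_sums x A}" by (rule finite_subset[OF sub fin])
  have m: "1 \<le> card A" using assms by (simp add: Suc_le_eq card_gt_0_iff)
  have "card {x. n \<in> new_sums x A} \<le> card (?P \<union> ?Q \<union> {n div 3})"
    by (rule card_mono[OF fin sub])
  also have "\<dots> \<le> card ?P + card ?Q + card {n div 3}"
    by (meson add_le_mono1 card_Un_le le_trans)
  also have "\<dots> \<le> (card A)\<^sup>2 + card A + 1"
    using card_times_le_square[OF assms(1)] card_image_le[OF assms(1)] by (intro add_mono) auto
  also have "\<dots> \<le> 3 * (card A)\<^sup>2"
    using m self_le_power[OF m, of 2] one_le_power[OF m, of 2] by simp
  finally show "card {x. n \<in> new_sums x A} \<le> 3 * (card A)\<^sup>2" .
qed

lemma sum_card_new_sums_le: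
  assumes "finite A" "A \<noteq> {}" "finite X" "finite F"
  shows "(\<Sum>x\<in>X. card (F \<inter> new_sums x A)) \<le> 3 * (card A)\<^sup>2 * card F"
proof -
  have "(\<Sum>x\<in>X. card {n \<in> F. n \<in> new_sums x A}) = (\<Sum>n\<in>F. card {x \<in> X. n \<in> new_sums x A})"
    by (rule sum_multicount_gen) (use assms in auto)
  also have "\<dots> \<le> (\<Sum>n\<in>F. 3 * (card A)\<^sup>2)"
  proof (rule sum_mono)
    fix n
    have "card {x \<in> X. n \<in> new_sums x A} \<le> card {x. n \<in> new_sums x A}"
      by (rule card_mono) (use card_completing_le[OF assms(1,2)] in auto)
    thus "card {x \<in> X. n \<in> new_sums x A} \<le> 3 * (card A)\<^sup>2"
      using card_completing_le(2)[OF assms(1,2)] le_trans by blast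
  qed
  finally show ?thesis by (simp add: Int_def mult.commute)
qed

text \<open>The solutions \<open>x\<close> of \<open>a + x = b + c\<close> and of \<open>x + x = b + c\<close>. The rounding in the second
  case only adds harmless values. The elements of \<open>A\<close> are themselves obstacles.\<close>

definition sidon_obstacles :: "int set \<Rightarrow> int set" where
  "sidon_obstacles A = (\<lambda>(a, b, c). b + c - a) ` (A \<times> A \<times> A) \<union> (\<lambda>(b, c). (b + c) div 2) ` (A \<times> A)"

lemma sidon_insert:
  assumes S: "sidon A" and x: "x \<notin> sidon_obstacles A"
  shows "x \<notin> A" "sidon (insert x A)"
proof -
  have 1: "x + a \<noteq> b + c" if "a \<in> A" "b \<in> A" "c \<in> A" for a b c
  proof
    assume "x + a = b + c"
    hence "x = (\<lambda>(a, b, c). b + c - a) (a, b, c)" by simp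
    thus False using x that unfolding sidon_obstacles_def by blast
  qed
  have 2: "x + x \<noteq> b + c" if "b \<in> A" "c \<in> A" for b c
  proof
    assume "x + x = b + c"
    hence "x = (\<lambda>(b, c). (b + c) div 2) (b, c)" by simp
    thus False using x that unfolding sidon_obstacles_def by blast
  qed
  show xA: "x \<notin> A" using 2[of x x] by auto
  show "sidon (insert x A)"
    unfolding sidon_def
  proof (intro ballI impI)
    fix a b c d
    assume *: "a \<in> insert x A" "b \<in> insert x A" "c \<in> insert x A" "d \<in> insert x A"
      and eq: "a + b = c + d"
    show "a = c \<or> a = d"
    proof (cases "a = x \<or> b = x \<or> c = x \<or> d = x")
      case False
      thus ?thesis using * eq S unfolding sidon_def by blast
    next
      case True
      show ?thesis
        using * eq True 1[of a c d] 1[of b c d] 1[of c a b] 1[of d a b] 2[of c d] 2[of a b]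
        by (cases "a = x"; cases "b = x"; cases "c = x"; cases "d = x") (simp_all add: add.commute)
    qed
  qed
qed

lemma card_sidon_obstacles:
  assumes "finite A"
  shows "finite (sidon_obstacles A)" "card (sidon_obstacles A) \<le> 2 * card A ^ 3"
proof -
  show "finite (sidon_obstacles A)" using assms by (auto simp: sidon_obstacles_def)
  have "card (sidon_obstacles A) \<le> card A ^ 3 + (card A)\<^sup>2"
    unfolding sidon_obstacles_def
    using card_image_le[of "A \<times> A \<times> A" "\<lambda>(a, b, c). b + c - a"] card_times_le_square[OF assms] assms
    by (intro order.trans[OF card_Un_le] add_mono) (auto simp: card_cartesian_product power3_eq_cube)
  also have "(card A)\<^sup>2 \<le> card A ^ 3"
    by (cases "card A = 0") (auto intro: power_increasing)
  finally show "card (sidon_obstacles A) \<le> 2 * card A ^ 3" by simp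
qed

section \<open>The greedy step\<close>

text \<open>The invariant of the construction. The emptiness of \<open>rich (Suc g) A\<close> says that every integer
  has at most \<open>g\<close> representations. The bounds on the lower levels are what allows this to be kept:
  their exponents fall in equal steps from 3, the trivial exponent for \<open>rich 1 A\<close>.\<close>

definition balanced :: "nat \<Rightarrow> int set \<Rightarrow> bool" where
  "balanced g A \<longleftrightarrow> finite A \<and> A \<noteq> {} \<and> sidon A \<and> rich (Suc g) A = {} \<and>
     (\<forall>j<g. real (card (rich (Suc j) A)) \<le> real (card A) powr (3 - 2 * real j / real g))"

text \<open>The amount by which a bound \<open>m powr e\<close> grows with \<open>m\<close>, hence the increase that one step
  may afford.\<close>

lemma powr_add_le_Suc_powr:
  assumes "1 \<le> m" "1 \<le> e"
  shows "real m powr e + real m powr (e - 1) \<le> real (Suc m) powr e"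
proof -
  have "real m powr e + real m powr (e - 1) = real (Suc m) * real m powr (e - 1)"
    using assms by (simp add: powr_diff field_simps)
  also have "\<dots> \<le> real (Suc m) * real (Suc m) powr (e - 1)"
    using assms by (intro mult_left_mono powr_mono2) auto
  also have "\<dots> = real (Suc m) powr e" by (simp add: powr_diff)
  finally show ?thesis .
qed

text \<open>In the notation of the proof, the increase of level \<open>j + 1\<close>, bounded by \<open>w j x\<close>, may be
  at most \<open>m powr (e j - 1)\<close>. Measured in these
  units, the average increase of each of the levels \<open>2, \<dots>, g + 1\<close> over the candidates is less than
  \<open>1 / g\<close>, so some candidate has total increase below 1 and respects all the allowances
  simultaneously. The exponent \<open>e j - 1\<close> vanishes for \<open>j = g\<close>, where the increase is thus an
  integer below 1.\<close>

lemma balanced_extend: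
  assumes g: "1 \<le> g" and bal: "balanced g A"
  shows "\<exists>x\<ge>1. real_of_int x \<le> 7 * real g * real (card A) powr (3 + 2 / real g) \<and>
    x \<notin> A \<and> balanced g (insert x A)"
proof -
  define m where "m = card A"
  define e where "e j = 3 - 2 * real j / real g" for j
  define M where "M = real m powr (3 + 2 / real g)"
  define w where "w j x = card (rich j A \<inter> new_sums x A)" for j x
  define N where "N = \<lfloor>7 * real g * M\<rfloor>"
  define X where "X = {1..N} - sidon_obstacles A"
  have fin: "finite A" and ne: "A \<noteq> {}" and S: "sidon A" and top: "rich (Suc g) A = {}"
    and R: "\<And>j. j < g \<Longrightarrow> real (card (rich (Suc j) A)) \<le> real m powr e j"
    using bal by (auto simp: balanced_def m_def e_def)
  have m: "1 \<le> m" using fin ne by (simp add: m_def Suc_le_eq card_gt_0_iff)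
  have m3: "real m ^ 3 \<le> M"
  proof -
    have "real m ^ 3 = real m powr 3" using m by simp
    also have "\<dots> \<le> M" unfolding M_def using m by (intro powr_mono) auto
    finally show ?thesis .
  qed
  have M1: "1 \<le> M"
  proof -
    have "1 \<le> real m ^ 3" using m by simp
    thus ?thesis using m3 by linarith
  qed
  have finX: "finite X" by (simp add: X_def)

  \<comment> \<open>The powers of \<open>m\<close> cancel to the same total for every level; this is what fixes the exponent
    \<open>3 + 2 / g\<close>.\<close>
  have step: "real (3 * m\<^sup>2 * card (rich j A)) / real m powr (e j - 1) \<le> 3 * M"
    if j: "j \<in> {1..g}" for j
  proof -
    have j': "j - 1 < g" "Suc (j - 1) = j" using j by auto
    have ej: "2 + e (j - 1) - (e j - 1) = 3 + 2 / real g"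
      using j g by (simp add: e_def of_nat_diff field_simps)
    have "real (3 * m\<^sup>2 * card (rich j A)) \<le> 3 * (real m powr 2 * real m powr e (j - 1))"
      using R[OF j'(1)] m unfolding j'(2) by (simp add: mult_left_mono)
    hence "real (3 * m\<^sup>2 * card (rich j A)) / real m powr (e j - 1)
        \<le> 3 * (real m powr 2 * real m powr e (j - 1)) / real m powr (e j - 1)"
      by (intro divide_right_mono) auto
    also have "\<dots> = 3 * M"
      unfolding M_def ej[symmetric] powr_diff powr_add by simp
    finally show ?thesis .
  qed

  have "(\<Sum>x\<in>X. \<Sum>j=1..g. real (w j x) / real m powr (e j - 1))
      = (\<Sum>j=1..g. real (\<Sum>x\<in>X. w j x) / real m powr (e j - 1))"
    by (subst sum.swap) (simp add: sum_divide_distrib)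
  also have "\<dots> \<le> (\<Sum>j=1..g. 3 * M)"
  proof (rule sum_mono)
    fix j assume j: "j \<in> {1..g}"
    have "(\<Sum>x\<in>X. w j x) \<le> 3 * m\<^sup>2 * card (rich j A)"
      unfolding w_def m_def
      using j by (intro sum_card_new_sums_le fin ne finX finite_rich) auto
    hence "real (\<Sum>x\<in>X. w j x) / real m powr (e j - 1)
        \<le> real (3 * m\<^sup>2 * card (rich j A)) / real m powr (e j - 1)"
      by (intro divide_right_mono) (auto simp only: of_nat_le_iff powr_ge_zero)
    thus "real (\<Sum>x\<in>X. w j x) / real m powr (e j - 1) \<le> 3 * M" using step[OF j] by simp
  qed
  also have "\<dots> = 3 * real g * M" by simp
  \<comment> \<open>From the \<open>7 * g * M\<close> candidates at most \<open>2 * M\<close> are Sidon obstacles and one is lost by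
    rounding; \<open>g * M \<ge> 1\<close> makes the factor 7 large enough.\<close>
  also have "\<dots> < real (card X)"
  proof -
    have "card {1..N} - card (sidon_obstacles A) \<le> card X"
      unfolding X_def by (rule diff_card_le_card_Diff[OF card_sidon_obstacles(1)[OF fin]])
    hence "nat N \<le> card X + 2 * m ^ 3"
      using card_sidon_obstacles(2)[OF fin] by (simp add: m_def)
    hence "real (nat N) \<le> real (card X + 2 * m ^ 3)" by (simp only: of_nat_le_iff)
    hence "real (nat N) \<le> real (card X) + 2 * M" using m3 by simp
    moreover have "7 * real g * M - 1 < real (nat N)"
      unfolding N_def by linarith
    moreover have "M \<le> real g * M" using g M1 by simp
    ultimately show ?thesis using M1 by linarith
  qed
  finally have lt: "(\<Sum>x\<in>X. \<Sum>j=1..g. real (w j x) / real m powr (e j - 1)) < real (card X)" .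
  have "\<exists>x\<in>X. (\<Sum>j=1..g. real (w j x) / real m powr (e j - 1)) < 1"
  proof (rule ccontr)
    assume "\<not> ?thesis"
    hence "(\<Sum>x\<in>X. 1) \<le> (\<Sum>x\<in>X. \<Sum>j=1..g. real (w j x) / real m powr (e j - 1))"
      by (intro sum_mono) auto
    thus False using lt by simp
  qed
  then obtain x where x: "x \<in> X" and
    small: "(\<Sum>j=1..g. real (w j x) / real m powr (e j - 1)) < 1" by blast
  have w: "real (w j x) < real m powr (e j - 1)" if "j \<in> {1..g}" for j
  proof -
    have "real (w j x) / real m powr (e j - 1)
        \<le> (\<Sum>j=1..g. real (w j x) / real m powr (e j - 1))"
      using that by (intro member_le_sum) auto
    hence "real (w j x) / real m powr (e j - 1) < 1" using small by linarith
    thus ?thesis using m by (simp add: field_simps)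
  qed
  have xA: "x \<notin> A" and SX: "sidon (insert x A)"
    using sidon_insert[OF S, of x] x by (auto simp: X_def)
  have cardI: "card (insert x A) = Suc m" using fin xA by (simp add: m_def)

  have "rich (Suc g) (insert x A) = {}"
  proof -
    have "w g x = 0" using w[of g] g m by (simp add: e_def)
    hence "rich g A \<inter> new_sums x A = {}"
      using finite_rich[OF fin g] by (simp add: w_def)
    thus ?thesis using rich_insert_subset[OF fin SX, of g] top by auto
  qed
  moreover have "real (card (rich (Suc j) (insert x A))) \<le> real (Suc m) powr e j" if "j < g" for j
  proof (cases "j = 0")
    case True
    have "real (card (rich 1 (insert x A))) \<le> real (Suc m ^ 3)"
      using card_rich_1_le[of "insert x A"] fin cardI by (simp only: of_nat_le_iff) simp
    thus ?thesis using True by (simp add: e_def)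
  next
    case False
    have "card (rich (Suc j) (insert x A)) \<le> card (rich (Suc j) A \<union> (rich j A \<inter> new_sums x A))"
      using False fin by (intro card_mono rich_insert_subset SX) (auto intro!: finite_rich)
    also have "\<dots> \<le> card (rich (Suc j) A) + w j x"
      unfolding w_def by (rule card_Un_le)
    finally have "real (card (rich (Suc j) (insert x A))) \<le> real (card (rich (Suc j) A) + w j x)"
      by (simp only: of_nat_le_iff)
    also have "\<dots> \<le> real m powr e j + real m powr (e j - 1)"
      using R[OF that] w[of j] False that by simp
    also have "\<dots> \<le> real (Suc m) powr e j"
      using that m by (intro powr_add_le_Suc_powr) (auto simp: e_def field_simps)
    finally show ?thesis .
  qed
  ultimately have "balanced g (insert x A)"
    unfolding balanced_def cardI using fin SX by (auto simp: e_def)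
  moreover have "1 \<le> x" "real_of_int x \<le> 7 * real g * M"
    using x by (auto simp: X_def N_def le_floor_iff)
  ultimately show ?thesis using xA unfolding M_def m_def by blast
qed

section \<open>The infinite set\<close>

lemma balanced_singleton:
  assumes "1 \<le> g"
  shows "balanced g {1}"
proof -
  have r: "r3 {1} n \<le> 1" for n
  proof -
    have "card (reps3 {1} n) \<le> card {(1::int, 1::int, 1::int)}"
      by (rule card_mono) (auto simp: reps3_def)
    thus ?thesis by (simp add: r3_def)
  qed
  have none: "rich (Suc j) {1} = {}" if "1 \<le> j" for j
  proof -
    have "\<not> Suc j \<le> r3 {1} n" for n using r[of n] that by linarith
    thus ?thesis by (simp add: rich_def)
  qed
  have "card (rich (Suc 0) {1}) \<le> 1" using card_rich_1_le[of "{1}"] by simp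
  hence "card (rich (Suc j) {1}) \<le> 1" for j using none by (cases "j = 0") auto
  thus ?thesis
    using none[OF assms]
    by (auto simp: balanced_def sidon_def)
qed

text \<open>The new elements need not be increasing: only the range from which each one is chosen grows
  with \<open>k\<close>.\<close>

lemma balanced_chain:
  assumes g: "1 \<le> g"
  obtains B :: "nat \<Rightarrow> int set" where "\<And>k. balanced g (B k)" "\<And>k. card (B k) = Suc k"
    "\<And>k. B k \<subseteq> {1..\<lfloor>7 * real g * real (Suc k) powr (3 + 2 / real g)\<rfloor>}" "mono B"
proof -
  let ?N = "\<lambda>k. 7 * real g * real (Suc k) powr (3 + 2 / real g)"
  have N: "?N k \<le> ?N (Suc k)" for k by (intro mult_left_mono powr_mono2) auto
  obtain B where B: "\<forall>k. (balanced g (B k) \<and> card (B k) = Suc k \<and> B k \<subseteq> {1..\<lfloor>?N k\<rfloor>}) \<and>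
      B k \<subseteq> B (Suc k)"
  proof (rule exE[OF dependent_nat_choice[of
      "\<lambda>k S. balanced g S \<and> card S = Suc k \<and> S \<subseteq> {1..\<lfloor>?N k\<rfloor>}" "\<lambda>_ S T. S \<subseteq> T"]])
    show "\<exists>S. balanced g S \<and> card S = Suc 0 \<and> S \<subseteq> {1..\<lfloor>?N 0\<rfloor>}"
      using balanced_singleton[OF g] g by (intro exI[of _ "{1}"]) (auto simp: le_floor_iff)
  next
    fix S k assume S: "balanced g S \<and> card S = Suc k \<and> S \<subseteq> {1..\<lfloor>?N k\<rfloor>}"
    then obtain x where x: "1 \<le> x" "real_of_int x \<le> ?N k" "x \<notin> S" "balanced g (insert x S)"
      using balanced_extend[OF g, of S] by auto
    have "\<lfloor>?N k\<rfloor> \<le> \<lfloor>?N (Suc k)\<rfloor>" by (rule floor_mono[OF N])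
    moreover have "x \<le> \<lfloor>?N k\<rfloor>" using x(2) by (simp add: le_floor_iff)
    ultimately have "insert x S \<subseteq> {1..\<lfloor>?N (Suc k)\<rfloor>}"
      using S x(1) by force
    moreover have "card (insert x S) = Suc (Suc k)"
      using S x(3) by (simp add: balanced_def)
    ultimately show "\<exists>T. (balanced g T \<and> card T = Suc (Suc k) \<and> T \<subseteq> {1..\<lfloor>?N (Suc k)\<rfloor>}) \<and> S \<subseteq> T"
      using x(4) by blast
  qed blast
  show thesis
    by (rule that[of B]) (use B in \<open>auto intro: mono_iff_le_Suc[THEN iffD2]\<close>)
qed

text \<open>The summands are positive, so an integer has only finitely many representations in the union,
  and all of them already occur in one member of the chain.\<close>

lemma B3_seq_chain_Union:
  fixes B :: "nat \<Rightarrow> int set"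
  assumes mono: "mono B" and pos: "\<And>k. B k \<subseteq> {1..}" and emp: "\<And>k. rich (Suc g) (B k) = {}"
  shows "B3_seq g (\<Union>k. B k)"
  unfolding B3_seq_def
proof
  fix n
  let ?A = "\<Union>k. B k"
  have fin: "finite (reps3 ?A n)"
    by (rule finite_reps3_positive) (use pos in auto)
  have "\<exists>k. P \<subseteq> reps3 (B k) n" if "finite P" "P \<subseteq> reps3 ?A n" for P
    using that
  proof (induction P)
    case (insert t P)
    then obtain k where k: "P \<subseteq> reps3 (B k) n" by auto
    obtain a b c where t: "t = (a, b, c)" by (metis surj_pair)
    have "(a, b, c) \<in> reps3 ?A n" using insert.prems t by auto
    then obtain k1 k2 k3 where "a \<in> B k1" "b \<in> B k2" "c \<in> B k3"
      and abc: "a \<le> b" "b \<le> c" "n = a + b + c" by (auto simp: reps3_def)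
    moreover define l where "l = k + k1 + k2 + k3"
    have "B k \<subseteq> B l" "B k1 \<subseteq> B l" "B k2 \<subseteq> B l" "B k3 \<subseteq> B l"
      by (simp_all add: monoD[OF mono] l_def)
    ultimately have "a \<in> B l" "b \<in> B l" "c \<in> B l" "P \<subseteq> reps3 (B l) n"
      using k reps3_mono[of "B k" "B l" n] by blast+
    moreover from this have "t \<in> reps3 (B l) n" using abc by (simp add: reps3_def t)
    ultimately show ?case by blast
  qed auto
  then obtain k where "reps3 ?A n \<subseteq> reps3 (B k) n" using fin by blast
  hence "r3 ?A n \<le> r3 (B k) n"
    unfolding r3_def by (intro card_mono finite_reps3_positive pos)
  also have "\<dots> \<le> g" using emp[of k] by (auto simp: rich_def not_less_eq_eq)
  finally show "finite (reps3 ?A n) \<and> r3 ?A n \<le> g" using fin by blast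
qed

text \<open>Inverting the size bound: all elements of \<open>B k\<close> are at most \<open>x\<close> as long as
  \<open>Suc k \<le> (x / C) powr (1 / e)\<close>. The largest such \<open>Suc k\<close> is a floor, at the cost of a factor
  2.\<close>

lemma counting_chain_Union_ge:
  assumes C: "0 < C" and e: "0 < e" and card: "\<And>k. card (B k) = Suc k"
    and bound: "\<And>k. B k \<subseteq> {1..\<lfloor>C * real (Suc k) powr e\<rfloor>}" and x: "C \<le> x"
  shows "(1 / C) powr (1 / e) / 2 * x powr (1 / e) \<le> real (counting (\<Union>k. B k) x)"
proof -
  define y where "y = (x / C) powr (1 / e)"
  have y1: "1 \<le> y" unfolding y_def using C e x by (intro ge_one_powr_ge_zero) auto
  define k where "k = nat \<lfloor>y\<rfloor> - 1"
  have k: "real (Suc k) \<le> y" "y \<le> 2 * real (Suc k)"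
  proof -
    have fl: "1 \<le> \<lfloor>y\<rfloor>" using y1 by simp
    hence Suc_k: "real (Suc k) = real_of_int \<lfloor>y\<rfloor>" by (simp add: k_def of_nat_diff)
    have "1 \<le> real_of_int \<lfloor>y\<rfloor>" using fl by simp
    thus "real (Suc k) \<le> y" "y \<le> 2 * real (Suc k)" unfolding Suc_k by linarith+
  qed
  have "C * real (Suc k) powr e \<le> C * y powr e"
    using k C e by (intro mult_left_mono powr_mono2) auto
  also have "\<dots> = x" using C e x by (simp add: y_def powr_powr)
  finally have le: "C * real (Suc k) powr e \<le> x" .
  have "B k \<subseteq> {a \<in> \<Union>k. B k. 1 \<le> a \<and> real_of_int a \<le> x}"
    using bound[of k] le by (fastforce simp: le_floor_iff)
  moreover have "finite {a \<in> \<Union>k. B k. 1 \<le> a \<and> real_of_int a \<le> x}"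
    by (rule finite_subset[of _ "{1..\<lfloor>x\<rfloor>}"]) (auto simp: le_floor_iff)
  ultimately have "Suc k \<le> counting (\<Union>k. B k) x"
    unfolding counting_def card[of k, symmetric] by (rule card_mono[rotated])
  hence Suc_k_le: "real (Suc k) \<le> real (counting (\<Union>k. B k) x)" by (simp only: of_nat_le_iff)
  have "(1 / C) powr (1 / e) / 2 * x powr (1 / e) = y / 2"
    using C x by (simp add: y_def powr_divide)
  also have "\<dots> \<le> real (Suc k)" using k(2) by simp
  also note Suc_k_le
  finally show ?thesis .
qed

lemma exists_dense_B3_seq:
  assumes g: "1 \<le> g"
  shows "\<exists>A. B3_seq g A \<and> (\<lambda>x. real (counting A x)) \<ggreater> (\<lambda>x. x powr (real g / (3 * real g + 2)))"
proof -
  define e where "e = 3 + 2 / real g"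
  have e: "0 < e" "1 / e = real g / (3 * real g + 2)"
    using g by (auto simp: e_def field_simps add_pos_nonneg)
  obtain B where B: "\<And>k. balanced g (B k)" "\<And>k. card (B k) = Suc k"
    "\<And>k. B k \<subseteq> {1..\<lfloor>7 * real g * real (Suc k) powr e\<rfloor>}" "mono B"
    using balanced_chain[OF g] unfolding e_def by blast
  have "B3_seq g (\<Union>k. B k)"
  proof (rule B3_seq_chain_Union[OF B(4)])
    show "B k \<subseteq> {1..}" for k using B(3)[of k] by (rule order.trans) auto
    show "rich (Suc g) (B k) = {}" for k using B(1)[of k] by (simp only: balanced_def)
  qed
  moreover have "(\<lambda>x. real (counting (\<Union>k. B k) x)) \<ggreater> (\<lambda>x. x powr (1 / e))"
    unfolding dominates_def
  proof (intro exI conjI allI impI)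
    show "0 < (1 / (7 * real g)) powr (1 / e) / 2" using g by simp
    show "(1 / (7 * real g)) powr (1 / e) / 2 * x powr (1 / e) \<le> real (counting (\<Union>k. B k) x)"
      if "7 * real g \<le> x" for x
      using g by (intro counting_chain_Union_ge e(1) B(2,3) that) simp
  qed
  ultimately show ?thesis unfolding e(2) by blast
qed

theorem theorem1p3:
  fixes \<epsilon> :: real and g :: nat
  assumes "\<epsilon> > 0" and "g \<ge> 1"
  shows "\<exists>A. B3_seq g A \<and>
    (\<lambda>x. real (counting A x)) \<ggreater> (\<lambda>x. x powr (real g / (3 * real g + 2) - \<epsilon>))"
proof -
  let ?\<alpha> = "real g / (3 * real g + 2)"
  obtain A c x0 where A: "B3_seq g A" and c: "c > 0"
    and le: "\<And>x. x \<ge> x0 \<Longrightarrow> c * x powr ?\<alpha> \<le> real (counting A x)"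
    using exists_dense_B3_seq[OF assms(2)] unfolding dominates_def by blast
  have "c * x powr (?\<alpha> - \<epsilon>) \<le> real (counting A x)" if "x \<ge> max x0 1" for x
  proof -
    have "c * x powr (?\<alpha> - \<epsilon>) \<le> c * x powr ?\<alpha>"
      using that c assms(1) by (intro mult_left_mono powr_mono) auto
    thus ?thesis using le[of x] that by simp
  qed
  thus ?thesis using A c unfolding dominates_def by blast
qed

end
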